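(* Fix $\epsilon\in(0,1/2)$. Then there exists a sequence $(n_k)_{k\ge1}$ of odd positive integers such that, as $k\to\infty$, $$\mathcal{P}_k(\mathsf{MAJ}_{n_k};\epsilon)\ge\Omega\left(\frac{1}{k^{2.01/(1-2\epsilon)^2}}\right).$$ Moreover, such a sequence can be chosen with $n_k=O\bigl(k^{4.01/(1-2\epsilon)^2}\bigr)$.
   Context: For odd $n$, $\mathsf{MAJ}_n:\{0,1\}^n\to\{0,1\}$ is $1$ if $\sum_{i=1}^n x_i>n/2$ and $0$ otherwise. For $f:\{0,1\}^n\to\{0,1\}$, $\mathcal{P}_k(f;\epsilon)=\mathbf{P}[f(y^1)=\dots=f(y^k)]$, where $x$ is uniform in $\{0,1\}^n$ and, given $x$, the events $\{y^i_j=x_j\}$ ($1\le i\le k$, $1\le j\le n$) are mutually independent, each of probability $1-\epsilon$. The constants implied by $\Omega$ and $O$ may depend on $\epsilon$ but not on $k$. *)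

theory Defs
  imports "HOL-Probability.Probability" "HOL-Library.Landau_Symbols"
begin

text \<open>
  Bit strings in $\{0,1\}^n$ are functions \<^typ>\<open>nat \<Rightarrow> bool\<close> that are \<^const>\<open>False\<close> outside
  \<open>{..<n}\<close>, with \<^const>\<open>True\<close> for 1 and \<^const>\<open>False\<close> for 0. The coordinates $1,\dots,n$ are
  numbered from 0.
\<close>

definition cube :: "nat \<Rightarrow> (nat \<Rightarrow> bool) set" where
  "cube n = PiE_dflt {..<n} False (\<lambda>_. UNIV)"

definition MAJ :: "nat \<Rightarrow> (nat \<Rightarrow> bool) \<Rightarrow> bool" where
  "MAJ n x \<longleftrightarrow> (\<Sum>j<n. of_bool (x j)) > real n / 2"

definition noisy_copy :: "nat \<Rightarrow> real \<Rightarrow> (nat \<Rightarrow> bool) \<Rightarrow> (nat \<Rightarrow> bool) pmf" where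
  "noisy_copy n \<epsilon> x =
     Pi_pmf {..<n} False (\<lambda>j. map_pmf (\<lambda>flip. if flip then \<not> x j else x j) (bernoulli_pmf \<epsilon>))"

definition noisy_copies :: "nat \<Rightarrow> nat \<Rightarrow> real \<Rightarrow> (nat \<Rightarrow> nat \<Rightarrow> bool) pmf" where
  "noisy_copies k n \<epsilon> =
     bind_pmf (pmf_of_set (cube n)) (\<lambda>x. Pi_pmf {..<k} (\<lambda>_. False) (\<lambda>_. noisy_copy n \<epsilon> x))"

definition agree_prob :: "nat \<Rightarrow> nat \<Rightarrow> ((nat \<Rightarrow> bool) \<Rightarrow> bool) \<Rightarrow> real \<Rightarrow> real" where
  "agree_prob k n f \<epsilon> =
     measure_pmf.prob (noisy_copies k n \<epsilon>) {y. \<forall>i<k. \<forall>i'<k. f (y i) = f (y i')}"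

end

theory Submission
  imports Defs "HOL-Probability.Hoeffding" "HOL-Real_Asymp.Real_Asymp"
begin

text \<open>
  Write \<open>\<rho> = 1 - 2 * \<epsilon>\<close> and condition on \<open>x\<close> being the all-ones string, which has probability
  \<open>1 / 2 ^ n\<close>. By Hoeffding's inequality a single noisy copy then has majority 0 with probability at
  most \<open>exp (- (\<rho>\<^sup>2 * n / 2))\<close>. For \<open>n = 2 * ln k / \<rho>\<^sup>2 + O(1)\<close> this is at most \<open>c / k\<close> with \<open>c < 1\<close>,
  so that all \<open>k\<close> copies have majority 1 with probability bounded below, while
  \<open>1 / 2 ^ n\<close> is of order \<open>k powr (- 2 * ln 2 / \<rho>\<^sup>2)\<close>. As \<open>2 * ln 2 < 2.01\<close>, even this crude choice,
  with \<open>n\<close> only logarithmic in \<open>k\<close>, is good enough.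
\<close>

text \<open>Dropping every \<open>y\<close> other than \<open>x\<close> from the integral over
  \<open>p\<close> leaves the left-hand side. This makes fixing a single source string
  rigorous.\<close>

lemma measure_bind_pmf_ge:
  "pmf p x * measure_pmf.prob (f x) A \<le> measure_pmf.prob (bind_pmf p f) A"
proof -
  have "ennreal (pmf p x * measure_pmf.prob (f x) A)
      = (\<integral>\<^sup>+y. emeasure (f y) A * indicator {x} y \<partial>measure_pmf p)"
    by (subst nn_integral_indicator_singleton)
       (simp_all add: measure_pmf_single ennreal_mult measure_pmf.emeasure_eq_measure mult.commute)
  also have "\<dots> \<le> (\<integral>\<^sup>+y. emeasure (f y) A \<partial>measure_pmf p)"
    by (intro nn_integral_mono) (auto split: split_indicator)
  also have "\<dots> = ennreal (measure_pmf.prob (bind_pmf p f) A)"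
    by (simp flip: measure_pmf.emeasure_eq_measure)
  finally show ?thesis
    by simp
qed

lemma pmf_of_set_cube:
  assumes "x \<in> cube n"
  shows "pmf (pmf_of_set (cube n)) x = 1 / 2 ^ n"
proof -
  have "finite (cube n)" "card (cube n) = 2 ^ n"
    by (auto simp: cube_def card_PiE_dflt)
  then show ?thesis
    using assms by (subst pmf_of_set) auto
qed

text \<open>A coordinate of the copy is 1 exactly when the noise leaves it alone. The coordinates
  are thus iid, so the number of ones is binomial.\<close>

lemma noisy_copy_all_ones:
  assumes "0 \<le> \<epsilon>" "\<epsilon> \<le> 1"
  shows "noisy_copy n \<epsilon> (\<lambda>j. j < n) = Pi_pmf {..<n} False (\<lambda>_. bernoulli_pmf (1 - \<epsilon>))"
proof -
  have "map_pmf Not (bernoulli_pmf \<epsilon>) = bernoulli_pmf (1 - \<epsilon>)"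
  proof (rule pmf_eqI)
    fix b
    \<comment> \<open>The argument \<open>b\<close> is written as the image of
      \<open>\<not> b\<close> under \<open>Not\<close>, so that injectivity of \<open>Not\<close>
      applies.\<close>
    have "pmf (map_pmf Not (bernoulli_pmf \<epsilon>)) (\<not> \<not> b) = pmf (bernoulli_pmf \<epsilon>) (\<not> b)"
      by (rule pmf_map_inj') (simp add: inj_def)
    then show "pmf (map_pmf Not (bernoulli_pmf \<epsilon>)) b = pmf (bernoulli_pmf (1 - \<epsilon>)) b"
      using assms by (cases b) auto
  qed
  moreover have "map_pmf (\<lambda>flip. if flip then \<not> j < n else j < n) (bernoulli_pmf \<epsilon>)
      = map_pmf Not (bernoulli_pmf \<epsilon>)" if "j < n" for j
    using that by (intro map_pmf_cong) auto
  ultimately show ?thesis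
    unfolding noisy_copy_def by (intro Pi_pmf_cong) auto
qed

lemma prob_MAJ_noisy_copy_all_ones:
  assumes "0 \<le> \<epsilon>" "\<epsilon> \<le> 1 / 2" "n > 0"
  shows "measure_pmf.prob (noisy_copy n \<epsilon> (\<lambda>j. j < n)) {y. MAJ n y}
    \<ge> 1 - exp (- ((1 - 2 * \<epsilon>)\<^sup>2 * real n / 2))"
proof -
  interpret binomial_distribution n "1 - \<epsilon>"
    using assms by unfold_locales auto
  define M where "M = noisy_copy n \<epsilon> (\<lambda>j. j < n)"
  have binom: "binomial_pmf n (1 - \<epsilon>) = map_pmf (\<lambda>y. card {j \<in> {..<n}. y j}) M"
    using assms by (simp only: M_def noisy_copy_all_ones) (rule binomial_pmf_altdef', auto)
  have MAJ: "MAJ n y \<longleftrightarrow> real (card {j \<in> {..<n}. y j}) > real n / 2" for y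
  proof -
    have "(\<Sum>j<n. of_bool (y j) :: real) = real (card {j \<in> {..<n}. y j})"
      by (simp add: of_bool_def flip: sum.inter_filter)
    then show ?thesis
      by (simp add: MAJ_def)
  qed
  have "measure_pmf.prob M {y. \<not> MAJ n y}
      = measure_pmf.prob (binomial_pmf n (1 - \<epsilon>)) {m. real m \<le> real n / 2}"
    unfolding binom by (simp add: vimage_def MAJ not_less)
  \<comment> \<open>The threshold becomes mean minus deviation, the form of Hoeffding's lower
    tail.\<close>
  also have "{m. real m \<le> real n / 2}
      = {m. real m \<le> real n * (1 - \<epsilon>) - real n * (1 / 2 - \<epsilon>)}"
    by (simp add: algebra_simps)
  also have "measure_pmf.prob (binomial_pmf n (1 - \<epsilon>)) \<dots>
      \<le> exp (- 2 * (real n * (1 / 2 - \<epsilon>))\<^sup>2 / real n)"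
    using assms by (intro prob_le) auto
  also have "- 2 * (real n * (1 / 2 - \<epsilon>))\<^sup>2 / real n = - ((1 - 2 * \<epsilon>)\<^sup>2 * real n / 2)"
    using assms by (simp add: power2_eq_square field_simps)
  finally have "measure_pmf.prob M {y. \<not> MAJ n y} \<le> exp (- ((1 - 2 * \<epsilon>)\<^sup>2 * real n / 2))" .
  moreover have "measure_pmf.prob M {y. \<not> MAJ n y} = 1 - measure_pmf.prob M {y. MAJ n y}"
    using measure_pmf.prob_compl[of "{y. MAJ n y}" M]
    by (simp add: Collect_neg_eq flip: Compl_eq_Diff_UNIV)
  ultimately show ?thesis
    by (simp add: M_def)
qed

text \<open>Given \<open>x\<close>, the copies are independent, and one way for them to agree is
  that \<open>f\<close> holds on all of them.\<close>

lemma agree_prob_ge: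
  assumes "x \<in> cube n"
  shows "agree_prob k n f \<epsilon> \<ge> measure_pmf.prob (noisy_copy n \<epsilon> x) {y. f y} ^ k / 2 ^ n"
proof -
  let ?P = "Pi_pmf {..<k} (\<lambda>_. False) (\<lambda>_. noisy_copy n \<epsilon> x)"
  have "measure_pmf.prob (noisy_copy n \<epsilon> x) {y. f y} ^ k
      = measure_pmf.prob ?P (Pi {..<k} (\<lambda>_. {y. f y}))"
    by (simp add: measure_Pi_pmf_Pi)
  also have "\<dots> \<le> measure_pmf.prob ?P {y. \<forall>i<k. \<forall>i'<k. f (y i) = f (y i')}"
    by (intro measure_pmf.finite_measure_mono) (auto simp: Pi_def)
  finally have "measure_pmf.prob (noisy_copy n \<epsilon> x) {y. f y} ^ k / 2 ^ n
      \<le> pmf (pmf_of_set (cube n)) x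
         * measure_pmf.prob ?P {y. \<forall>i<k. \<forall>i'<k. f (y i) = f (y i')}"
    by (simp add: pmf_of_set_cube[OF assms] divide_right_mono)
  also have "\<dots> \<le> agree_prob k n f \<epsilon>"
    unfolding agree_prob_def noisy_copies_def by (rule measure_bind_pmf_ge)
  finally show ?thesis .
qed

text \<open>The term \<open>2 * ln k / r\<close> in the bound on \<open>n\<close> pushes the failure
  probability of one copy down to \<open>1 / k\<close>; the extra \<open>1\<close> gains the factor
  \<open>exp (- (r / 2)) < 1\<close>, which keeps the result positive uniformly in
  \<open>k\<close>.\<close>

lemma agree_prob_MAJ_ge:
  assumes "0 \<le> \<epsilon>" "\<epsilon> < 1 / 2" "k \<ge> 1"
    and n: "real n \<ge> 2 * ln (real k) / (1 - 2 * \<epsilon>)\<^sup>2 + 1"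
  shows "agree_prob k n (MAJ n) \<epsilon> \<ge> (1 - exp (- ((1 - 2 * \<epsilon>)\<^sup>2 / 2))) / 2 ^ n"
proof -
  define r where "r = (1 - 2 * \<epsilon>)\<^sup>2"
  define q where "q = exp (- (r * real n / 2))"
  have r: "r > 0"
    using assms by (simp add: r_def)
  have "ln (real k) \<ge> 0"
    using assms by simp
  then have "real n \<ge> 1"
    using n r unfolding r_def[symmetric] by (smt (verit) divide_nonneg_pos)
  then have "n > 0"
    by simp
  have "2 * ln (real k) + r \<le> r * real n"
    using mult_left_mono[OF n[folded r_def], of r] r by (simp add: algebra_simps)
  then have "q \<le> exp (- ln (real k) + - (r / 2))"
    by (simp add: q_def field_simps)
  also have "\<dots> = exp (- (r / 2)) / real k"
    using assms by (simp only: exp_add) (simp add: exp_minus field_simps)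
  finally have kq: "real k * q \<le> exp (- (r / 2))"
    using assms by (simp add: field_simps)
  have q: "0 \<le> q" "q \<le> 1"
    using r by (simp_all add: q_def)
  have "1 - exp (- (r / 2)) \<le> 1 + real k * (- q)"
    using kq by simp
  \<comment> \<open>Bernoulli's inequality plays the part of a union bound over the \<open>k\<close>
    copies.\<close>
  also have "\<dots> \<le> (1 + (- q)) ^ k"
    using q by (intro Bernoulli_inequality) auto
  also have "\<dots> \<le> measure_pmf.prob (noisy_copy n \<epsilon> (\<lambda>j. j < n)) {y. MAJ n y} ^ k"
    using prob_MAJ_noisy_copy_all_ones[of \<epsilon> n] assms q \<open>n > 0\<close>
    by (intro power_mono) (auto simp: q_def r_def)
  finally have "(1 - exp (- (r / 2))) / 2 ^ n
      \<le> measure_pmf.prob (noisy_copy n \<epsilon> (\<lambda>j. j < n)) {y. MAJ n y} ^ k / 2 ^ n"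
    by (simp add: divide_right_mono)
  \<comment> \<open>The all-ones string is encoded as \<open>\<lambda>j. j < n\<close> because
    members of \<open>cube n\<close> are \<open>False\<close> outside \<open>{..<n}\<close>.\<close>
  also have "\<dots> \<le> agree_prob k n (MAJ n) \<epsilon>"
    by (rule agree_prob_ge) (auto simp: cube_def PiE_dflt_def)
  finally show ?thesis
    by (simp add: r_def)
qed

theorem theorem1p7:
  fixes \<epsilon> :: real
  assumes "0 < \<epsilon>" and "\<epsilon> < 1 / 2"
  shows "\<exists>n :: nat \<Rightarrow> nat.
    (\<forall>k\<ge>1. odd (n k) \<and> n k > 0) \<and>
    (\<lambda>k. agree_prob k (n k) (MAJ (n k)) \<epsilon>)
      \<in> \<Omega>(\<lambda>k. 1 / real k powr (2.01 / (1 - 2 * \<epsilon>)\<^sup>2)) \<and>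
    (\<lambda>k. real (n k)) \<in> O(\<lambda>k. real k powr (4.01 / (1 - 2 * \<epsilon>)\<^sup>2))"
proof -
  define r where "r = (1 - 2 * \<epsilon>)\<^sup>2"
  \<comment> \<open>For \<open>k \<ge> 1\<close> this is the least odd integer that is at least
    \<open>2 * ln k / r + 1\<close>.\<close>
  define n where "n k = 2 * nat \<lceil>ln (real k) / r\<rceil> + 1" for k
  \<comment> \<open>The divisor \<open>8 = 2 ^ 3\<close> absorbs the \<open>3\<close> in the upper
    bound on \<open>n k\<close>.\<close>
  define c where "c = (1 - exp (- (r / 2))) / 8"
  have r: "r > 0"
    using assms by (simp add: r_def)
  have c: "c > 0"
    using r by (simp add: c_def)
  have n_bounds: "real (n k) \<ge> 2 * ln (real k) / r + 1" "real (n k) \<le> 2 * ln (real k) / r + 3"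
    if "k \<ge> 1" for k
  proof -
    have "ln (real k) / r \<ge> 0"
      using that r by simp
    then have "real (nat \<lceil>ln (real k) / r\<rceil>) \<ge> ln (real k) / r"
      "real (nat \<lceil>ln (real k) / r\<rceil>) \<le> ln (real k) / r + 1"
      by linarith+
    then show "real (n k) \<ge> 2 * ln (real k) / r + 1" "real (n k) \<le> 2 * ln (real k) / r + 3"
      by (simp_all add: n_def)
  qed
  have "c * (1 / real k powr (2.01 / r)) \<le> agree_prob k (n k) (MAJ (n k)) \<epsilon>" if "k \<ge> 1" for k
  proof -
    \<comment> \<open>This crude bound already gives
      \<open>2 powr (2 * ln k / r) \<le> k powr (2 / r)\<close>.\<close>
    have "ln (2 :: real) \<le> 1"
      using ln_le_minus_one[of "2 :: real"] by simp
    then have "2 * ln (real k) / r * ln 2 \<le> 2 * ln (real k) / r * 1"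
      using that r by (intro mult_left_mono) auto
    also have "\<dots> \<le> 2.01 / r * ln (real k)"
      using that r by (simp add: field_simps)
    finally have ln_le: "2 * ln (real k) / r * ln 2 \<le> 2.01 / r * ln (real k)" .
    have "(2 :: real) ^ n k = 2 powr real (n k)"
      by (simp add: powr_realpow)
    also have "\<dots> \<le> 2 powr (2 * ln (real k) / r + 3)"
      using n_bounds(2)[OF that] by (intro powr_mono) auto
    also have "\<dots> = 2 powr (2 * ln (real k) / r) * 8"
      by (simp add: powr_add)
    also have "2 powr (2 * ln (real k) / r) \<le> real k powr (2.01 / r)"
      using that ln_le by (simp add: powr_def)
    finally have pow2_le: "(2 :: real) ^ n k \<le> real k powr (2.01 / r) * 8"
      by simp
    have "c * (1 / real k powr (2.01 / r)) = 8 * c / (real k powr (2.01 / r) * 8)"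
      by simp
    also have "\<dots> \<le> 8 * c / 2 ^ n k"
      using c pow2_le that by (intro divide_left_mono) auto
    also have "8 * c = 1 - exp (- (r / 2))"
      by (simp add: c_def)
    also have "(1 - exp (- (r / 2))) / 2 ^ n k \<le> agree_prob k (n k) (MAJ (n k)) \<epsilon>"
      using agree_prob_MAJ_ge[of \<epsilon> k "n k"] assms n_bounds(1)[OF that] that
      by (simp add: r_def)
    finally show ?thesis .
  qed
  then have lower: "(\<lambda>k. agree_prob k (n k) (MAJ (n k)) \<epsilon>)
      \<in> \<Omega>(\<lambda>k. 1 / real k powr (2.01 / r))"
    using c
    by (intro landau_omega.bigI[of c] eventually_mono[OF eventually_ge_at_top[of 1]])
       (auto simp: agree_prob_def)
  have "(\<lambda>k. real (n k)) \<in> O(\<lambda>k. 2 * ln (real k) / r + 3)"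
    using n_bounds(2)
    by (intro bigoI[of _ 1] eventually_mono[OF eventually_ge_at_top[of 1]]) fastforce
  \<comment> \<open>A logarithm is dominated by every positive power of \<open>k\<close>.\<close>
  also have "(\<lambda>k. 2 * ln (real k) / r + 3) \<in> O(\<lambda>k. real k powr (4.01 / r))"
    using r by real_asymp
  finally have "(\<lambda>k. real (n k)) \<in> O(\<lambda>k. real k powr (4.01 / r))" .
  with lower show ?thesis
    unfolding r_def by (intro exI[of _ n]) (auto simp: n_def)
qed

end
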